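(* For every $n\in\mathbb{N}=\{1,2,3,\ldots\}$, $$\ln\Bigl(n+\frac12\Bigr)+\gamma<H_n\le\ln\bigl(n+e^{1-\gamma}-1\bigr)+\gamma .$$
   Context: $H_n=\sum_{k=1}^n\frac1k$ is the $n$-th harmonic number, and $\gamma=0.577\ldots$ is the Euler–Mascheroni constant. *)

theory Defs
  imports "HOL-Analysis.Analysis"
begin

end

theory Submission
  imports Defs "HOL-Real_Asymp.Real_Asymp"
begin

text \<open>
  Both bounds compare \<open>H\<^sub>n\<close> with \<open>ln (n + c)\<close> for a fixed shift \<open>c\<close>.  The sequence
  \<open>d\<^sub>n = H\<^sub>n - ln (n + c)\<close> tends to the Euler--Mascheroni constant \<open>\<gamma>\<close> whatever \<open>c\<close> is, so
  everything depends on how it approaches its limit, that is, on the sign of the increments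
  \<open>d\<^sub>n\<^sub>+\<^sub>1 - d\<^sub>n = f n\<close> with \<open>f x = 1 / (x + 1) - ln (x + 1 + c) + ln (x + c)\<close>.

  The function \<open>f\<close> vanishes at infinity, and over a positive denominator its derivative has the
  affine numerator \<open>(1 - 2 c) x + (1 - c - c\<^sup>2)\<close>.  For \<open>c = 1/2\<close> this numerator is the positive
  constant \<open>1/4\<close>.  Hence \<open>f\<close> increases to \<open>0\<close>, so it is negative, the sequence \<open>d\<close> is strictly
  decreasing, and \<open>d\<^sub>n > \<gamma>\<close>: this is the lower bound.

  For the upper bound the shift is \<open>c = exp (1 - \<gamma>) - 1\<close>, chosen so that \<open>d\<^sub>1 = \<gamma>\<close> as well.  No
  numerical knowledge about \<open>c\<close> is needed.  An affine numerator changes sign at most once, and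
  for \<open>c > -1\<close> it can become negative on \<open>x \<ge> 1\<close> only from some point on; so once \<open>f\<close> starts to
  decrease it decreases all the way to its limit \<open>0\<close> and is positive there.  Therefore \<open>f\<close>, once
  nonnegative, remains so: \<open>d\<close> first decreases from \<open>d\<^sub>1\<close> and then increases towards \<open>\<gamma>\<close>
  (either phase may be absent), and it never exceeds the larger of \<open>d\<^sub>1\<close> and \<open>\<gamma>\<close>.
\<close>

definition harm_ln_increment :: "real \<Rightarrow> real \<Rightarrow> real" where
  "harm_ln_increment c x = 1 / (x + 1) - ln (x + 1 + c) + ln (x + c)"

lemma harm_diff_ln_shift_Suc:
  "harm (Suc n) - ln (real (Suc n) + c) =
     (harm n - ln (real n + c)) + harm_ln_increment c (real n)"
  by (simp add: harm_Suc harm_ln_increment_def inverse_eq_divide add_ac)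

lemma harm_diff_ln_shift_LIMSEQ:
  fixes c :: real
  shows "(\<lambda>n. harm n - ln (real n + c)) \<longlonglongrightarrow> euler_mascheroni"
proof -
  have "((\<lambda>x::real. ln x - ln (x + c)) \<longlongrightarrow> 0) at_top"
    by real_asymp
  hence "(\<lambda>n. ln (real n) - ln (real n + c)) \<longlonglongrightarrow> 0"
    by (rule filterlim_compose) (rule filterlim_real_sequentially)
  from tendsto_add[OF euler_mascheroni_LIMSEQ this] show ?thesis
    by simp
qed

lemma harm_ln_increment_at_top: "(harm_ln_increment c \<longlongrightarrow> 0) at_top"
  unfolding harm_ln_increment_def[abs_def] by real_asymp

lemma has_derivative_harm_ln_increment:
  assumes "x + c > 0" "x + 1 > 0"
  shows "(harm_ln_increment c has_real_derivative
           ((1 - 2 * c) * x + (1 - c - c\<^sup>2)) / ((x + 1)\<^sup>2 * (x + c) * (x + 1 + c))) (at x)"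
proof -
  have "(harm_ln_increment c has_real_derivative
           - (1 / (x + 1)\<^sup>2) - 1 / (x + 1 + c) + 1 / (x + c)) (at x)"
    unfolding harm_ln_increment_def[abs_def] using assms
    by (auto intro!: derivative_eq_intros simp: power2_eq_square)
  moreover have "- (1 / (x + 1)\<^sup>2) - 1 / (x + 1 + c) + 1 / (x + c) =
       ((1 - 2 * c) * x + (1 - c - c\<^sup>2)) / ((x + 1)\<^sup>2 * (x + c) * (x + 1 + c))"
    using assms by (simp add: divide_simps) algebra
  ultimately show ?thesis by simp
qed

lemma harm_ln_increment_half_neg:
  assumes "x \<ge> 0"
  shows "harm_ln_increment (1/2) x < 0"
proof -
  have "0 < - harm_ln_increment (1/2) x"
  proof (rule DERIV_neg_imp_decreasing_at_top[where f = "\<lambda>t. - harm_ln_increment (1/2) t"])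
    show "((\<lambda>t. - harm_ln_increment (1/2) t) \<longlongrightarrow> 0) at_top"
      using tendsto_minus[OF harm_ln_increment_at_top] by simp
  next
    fix t :: real assume "x \<le> t"
    hence t: "t \<ge> 0" using assms by simp
    define D where "D = ((1 - 2 * (1/2)) * t + (1 - 1/2 - (1/2)\<^sup>2)) /
      ((t + 1)\<^sup>2 * (t + 1/2) * (t + 1 + 1/2))"
    have "D > 0"
      unfolding D_def using t
      by (intro divide_pos_pos mult_pos_pos) (auto simp: power2_eq_square)
    moreover have "((\<lambda>t. - harm_ln_increment (1/2) t) has_real_derivative - D) (at t)"
      unfolding D_def using t by (intro DERIV_minus has_derivative_harm_ln_increment) auto
    ultimately show "\<exists>y. ((\<lambda>t. - harm_ln_increment (1/2) t) has_real_derivative y) (at t) \<and> y < 0"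
      by force
  qed
  thus ?thesis by simp
qed

text \<open>
  If the increment dropped below \<open>0\<close> after being nonnegative, its derivative would be negative
  somewhere in between.  From there on it would be strictly decreasing with limit \<open>0\<close>, hence
  positive.
\<close>

lemma harm_ln_increment_stays_nonneg:
  assumes c: "c > -1" and x: "1 \<le> x" "x \<le> y" and nonneg: "harm_ln_increment c x \<ge> 0"
  shows "harm_ln_increment c y \<ge> 0"
proof (rule ccontr)
  assume neg: "\<not> harm_ln_increment c y \<ge> 0"
  define num where "num t = (1 - 2 * c) * t + (1 - c - c\<^sup>2)" for t
  define den where "den t = (t + 1)\<^sup>2 * (t + c) * (t + 1 + c)" for t
  have den: "den t > 0" if "t \<ge> 1" for t
    unfolding den_def using that c by (intro mult_pos_pos) auto
  have deriv: "(harm_ln_increment c has_real_derivative num t / den t) (at t)" if "t \<ge> 1" for t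
    unfolding num_def den_def using that c by (intro has_derivative_harm_ln_increment) auto
  have "x < y" using x neg nonneg by (cases "x = y") auto
  then obtain z where z: "x < z" "z < y"
      "harm_ln_increment c y - harm_ln_increment c x = (y - x) * (num z / den z)"
    using MVT2[of x y "harm_ln_increment c" "\<lambda>t. num t / den t"] deriv x by force
  have "(y - x) * (num z / den z) < 0" using z(3) neg nonneg by linarith
  hence num_z: "num z < 0"
    using \<open>x < y\<close> den[of z] z x by (auto simp: mult_less_0_iff divide_less_0_iff)
  have c_half: "c > 1/2"
  proof (rule ccontr)
    assume "\<not> c > 1/2"
    hence le: "c \<le> 1/2" by simp
    \<comment> \<open>The slope is now nonnegative, so \<open>num z \<ge> num 1 = 2 - 3 c - c\<^sup>2\<close>, which is positive:
      \<open>c\<^sup>2 \<le> (1 - c) / 2\<close> on \<open>[-1, 1/2]\<close>, whence \<open>num 1 \<ge> (3 - 5 c) / 2 \<ge> 1/4\<close>.\<close>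
    have "(1 - 2 * c) * 1 \<le> (1 - 2 * c) * z"
      using le z x by (intro mult_left_mono) auto
    moreover have "(c + 1) * (1/2 - c) \<ge> 0" using c le by simp
    hence "c\<^sup>2 \<le> 1/2 - c/2" by (simp add: algebra_simps power2_eq_square)
    ultimately show False using num_z le by (simp add: num_def)
  qed
  have "harm_ln_increment c y > 0"
  proof (rule DERIV_neg_imp_decreasing_at_top[OF _ harm_ln_increment_at_top])
    fix t assume "y \<le> t"
    hence t: "z \<le> t" "1 \<le> t" using z x by auto
    have "(1 - 2 * c) * t \<le> (1 - 2 * c) * z"
      using c_half t by (intro mult_left_mono_neg) auto
    hence "num t < 0" using num_z by (simp add: num_def)
    hence "num t / den t < 0" using den[OF t(2)] by (rule divide_neg_pos)
    thus "\<exists>y. (harm_ln_increment c has_real_derivative y) (at t) \<and> y < 0"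
      using deriv[OF t(2)] by blast
  qed
  thus False using neg by simp
qed

lemma harm_diff_ln_half_gt_euler_mascheroni:
  "harm n - ln (real n + 1/2) > (euler_mascheroni :: real)"
proof -
  define d where "d k = harm k - ln (real k + 1/2)" for k :: nat
  have less: "d (Suc k) < d k" for k
    using harm_diff_ln_shift_Suc[of k "1/2"] harm_ln_increment_half_neg[of "real k"]
    by (simp add: d_def)
  have "decseq d"
    by (rule decseq_SucI) (rule less_imp_le[OF less])
  moreover have "d \<longlonglongrightarrow> euler_mascheroni"
    unfolding d_def[abs_def] by (rule harm_diff_ln_shift_LIMSEQ)
  ultimately have "euler_mascheroni \<le> d (Suc n)"
    by (rule decseq_ge)
  with less[of n] show ?thesis by (simp add: d_def)
qed

text \<open>
  Up to index \<open>n\<close> either only negative increments have occurred, so the value is below the initial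
  one, or a nonnegative increment has occurred, so from there on the sequence increases to its
  limit.
\<close>

lemma harm_diff_ln_shift_le_max:
  fixes c :: real
  assumes c: "c > -1" and n: "n \<ge> 1"
  shows "harm n - ln (real n + c) \<le> max (1 - ln (1 + c)) euler_mascheroni"
proof -
  define d where "d k = harm k - ln (real k + c)" for k :: nat
  have step: "d (Suc k) = d k + harm_ln_increment c (real k)" for k
    unfolding d_def by (rule harm_diff_ln_shift_Suc)
  have lim: "d \<longlonglongrightarrow> euler_mascheroni"
    unfolding d_def[abs_def] by (rule harm_diff_ln_shift_LIMSEQ)
  show ?thesis
  proof (cases "\<exists>k. 1 \<le> k \<and> k < n \<and> harm_ln_increment c (real k) \<ge> 0")
    case True
    then obtain k where k: "1 \<le> k" "k < n" "harm_ln_increment c (real k) \<ge> 0" by blast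
    have "incseq (\<lambda>i. d (i + n))"
    proof (rule incseq_SucI)
      fix i
      have "harm_ln_increment c (real (i + n)) \<ge> 0"
        using harm_ln_increment_stays_nonneg[OF c, of "real k" "real (i + n)"] k by simp
      thus "d (i + n) \<le> d (Suc i + n)" using step[of "i + n"] by simp
    qed
    from incseq_le[OF this LIMSEQ_ignore_initial_segment[OF lim, of n], of 0]
    show ?thesis by (simp add: d_def)
  next
    case False
    from n have "d n \<le> d 1"
    proof (rule dec_induct)
      fix k assume "1 \<le> k" "k < n" "d k \<le> d 1"
      thus "d (Suc k) \<le> d 1" using False step[of k] by force
    qed simp
    thus ?thesis by (simp add: d_def harm_expand)
  qed
qed

theorem theorem5:
  fixes n :: nat
  assumes "n \<ge> 1"
  shows "ln (real n + 1 / 2) + euler_mascheroni < (harm n :: real)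
    \<and> (harm n :: real) \<le> ln (real n + exp (1 - euler_mascheroni) - 1) + euler_mascheroni"
proof
  show "ln (real n + 1 / 2) + euler_mascheroni < (harm n :: real)"
    using harm_diff_ln_half_gt_euler_mascheroni[of n] by simp
next
  define c :: real where "c = exp (1 - euler_mascheroni) - 1"
  have "c > -1" by (simp add: c_def)
  moreover have "1 - ln (1 + c) = euler_mascheroni" by (simp add: c_def)
  ultimately have "harm n - ln (real n + c) \<le> euler_mascheroni"
    using harm_diff_ln_shift_le_max[of c n] assms by simp
  thus "(harm n :: real) \<le> ln (real n + exp (1 - euler_mascheroni) - 1) + euler_mascheroni"
    by (simp add: c_def add_diff_eq)
qed

end
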